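(* Let $K/\mathbb{Q}$ be a finite Galois extension with Galois group $G$ and ring of integers $Z_K$, and let $\mu(K)$ be its group of roots of unity. Let $\eta \in K^\times \setminus \mu(K)$ and let $\nu$ be a positive integer such that $\nu\eta \in Z_K$. Put $c_0(\eta) = \max_{\sigma \in G} |\eta^\sigma|$ (complex absolute value). Then for every prime number $p$ prime to $\eta$ and to $\nu$, if $\eta^k \equiv \zeta \pmod p$ for some $\zeta \in \mu(K)$ and some integer $k \geq 1$, then $$k \geq \frac{\log(p) - \log(2)}{\max\big(\log(\nu\, c_0(\eta)),\ \log(\nu)\big)}.$$ If moreover $\eta \in Z_K$ (i.e. $\nu = 1$), then $k \geq \dfrac{\log(p-1)}{\log(c_0(\eta))}$. In particular, the order of the image of $\eta$ in $Z_{K,(p)}\big/\mu(K)\cdot(1+pZ_{K,(p)})$, and a fortiori the order $o_p(\eta)$ (the least $k\ge1$ with $\eta^k\equiv 1 \pmod p$), satisfy these inequalities.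
   Context: $Z_{K,(p)}$ denotes the ring of $p$-integers of $K$ (elements of $K$ that are integral at all primes above $p$); congruences modulo $p$ are taken in $Z_{K,(p)}$. *)

theory Defs
  imports "HOL-Analysis.Analysis" "HOL-Algebra.Algebraic_Closure_Type"
begin

text \<open>
  Number fields are taken inside \<^typ>\<open>complex\<close>, so that the absolute value of an element and of
  its conjugates is \<^const>\<open>cmod\<close>.
\<close>

abbreviation complex_ring :: "complex ring" where
  "complex_ring \<equiv> ring_of_type_algebra"

text \<open>Automorphisms of \<open>K\<close> are made \<^const>\<open>extensional\<close> so that each one is a single function.\<close>

definition galois_group :: "complex set \<Rightarrow> (complex \<Rightarrow> complex) set" where
  "galois_group K =
     {\<sigma> \<in> extensional K.
        \<sigma> \<in> ring_iso (complex_ring\<lparr>carrier := K\<rparr>) (complex_ring\<lparr>carrier := K\<rparr>) \<and>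
        (\<forall>x\<in>\<rat>. \<sigma> x = x)}"

definition finite_galois :: "complex set \<Rightarrow> bool" where
  "finite_galois K \<longleftrightarrow>
     subfield K complex_ring \<and>
     ring.finite_dimension complex_ring \<rat> K \<and>
     {x \<in> K. \<forall>\<sigma>\<in>galois_group K. \<sigma> x = x} = \<rat>"

definition ring_of_integers :: "complex set \<Rightarrow> complex set" where
  "ring_of_integers K = {x \<in> K. algebraic_int x}"

definition roots_of_unity :: "complex set \<Rightarrow> complex set" where
  "roots_of_unity K = {z \<in> K. \<exists>n::nat. n > 0 \<and> z ^ n = 1}"

definition max_conjugate :: "complex set \<Rightarrow> complex \<Rightarrow> real" where
  "max_conjugate K x = Max ((\<lambda>\<sigma>. cmod (\<sigma> x)) ` galois_group K)"

definition primes_above :: "complex set \<Rightarrow> nat \<Rightarrow> complex set set" where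
  "primes_above K p =
     {P. primeideal P (complex_ring\<lparr>carrier := ring_of_integers K\<rparr>) \<and> of_nat p \<in> P}"

text \<open>Integrality at \<open>P\<close> is membership in the localization of the ring of integers at \<open>P\<close>.\<close>

definition integral_at :: "complex set \<Rightarrow> complex set \<Rightarrow> complex \<Rightarrow> bool" where
  "integral_at K P x \<longleftrightarrow>
     (\<exists>a\<in>ring_of_integers K. \<exists>b\<in>ring_of_integers K - P. x = a / b)"

definition p_integers :: "complex set \<Rightarrow> nat \<Rightarrow> complex set" where
  "p_integers K p = {x \<in> K. \<forall>P\<in>primes_above K p. integral_at K P x}"

text \<open>
  \<open>p\<close> is prime to \<open>x\<close> when no prime above \<open>p\<close> occurs in the factorization of the fractional
  ideal \<open>(x)\<close>, i.e. \<open>x\<close> has valuation 0 at each of them.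
\<close>

definition prime_to :: "complex set \<Rightarrow> nat \<Rightarrow> complex \<Rightarrow> bool" where
  "prime_to K p x \<longleftrightarrow>
     x \<in> K - {0} \<and> (\<forall>P\<in>primes_above K p. integral_at K P x \<and> integral_at K P (inverse x))"

definition cong_mod :: "complex set \<Rightarrow> nat \<Rightarrow> complex \<Rightarrow> complex \<Rightarrow> bool" where
  "cong_mod K p x y \<longleftrightarrow>
     x \<in> p_integers K p \<and> y \<in> p_integers K p \<and> (\<exists>z\<in>p_integers K p. x - y = of_nat p * z)"

definition p_unit_group :: "complex set \<Rightarrow> nat \<Rightarrow> complex monoid" where
  "p_unit_group K p = units_of (complex_ring\<lparr>carrier := p_integers K p\<rparr>)"

definition mu_principal_units :: "complex set \<Rightarrow> nat \<Rightarrow> complex set" where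
  "mu_principal_units K p =
     {\<zeta> * (1 + of_nat p * z) | \<zeta> z. \<zeta> \<in> roots_of_unity K \<and> z \<in> p_integers K p}"

text \<open>\<^const>\<open>group.ord\<close> is 0 on elements of infinite order.\<close>

definition order_mod_mu :: "complex set \<Rightarrow> nat \<Rightarrow> complex \<Rightarrow> nat" where
  "order_mod_mu K p x =
     group.ord (p_unit_group K p Mod mu_principal_units K p)
       (mu_principal_units K p #>\<^bsub>p_unit_group K p\<^esub> x)"

definition order_mod :: "complex set \<Rightarrow> nat \<Rightarrow> complex \<Rightarrow> nat" where
  "order_mod K p x = (LEAST k. k \<ge> 1 \<and> cong_mod K p (x ^ k) 1)"

end

theory Submission
  imports Defs "Jordan_Normal_Form.Char_Poly"
begin

text \<open>
  If \<open>\<eta> ^ k \<equiv> \<zeta>\<close> modulo \<open>p\<close>, then \<open>w = \<nu> ^ k * (\<eta> ^ k - \<zeta>) / p\<close> is an algebraic integer of \<open>K\<close>,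
  and \<open>w \<noteq> 0\<close> because \<open>\<eta>\<close> is not a root of unity. Its norm is a nonzero integer, so some
  conjugate of \<open>w\<close> has absolute value at least 1, which gives \<open>p \<le> \<nu> ^ k * (c\<^sub>0 ^ k + 1)\<close>.
  Both inequalities follow by taking logarithms. A vanishing denominator needs no separate
  argument (Kronecker's theorem would exclude it), since then the quotient is 0.

  The two orders are finite because the powers of the algebraic integer \<open>\<nu> * \<eta>\<close> lie in a finitely
  generated group, so two of them agree modulo \<open>p\<close>, and \<open>\<nu> * \<eta>\<close> and \<open>\<nu>\<close> are units at \<open>p\<close>.
\<close>

section \<open>Algebraic integers\<close>

text \<open>Determinant trick: multiplication by x acts on the finite family S through a matrix over
  the base ring. The vector of the elements of S is an eigenvector for x, nonzero because S has a
  nonzero element, so x is a root of the monic characteristic polynomial. The base ring enters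
  through \<open>hom\<close> so that the same argument serves integers and rationals.\<close>

lemma stable_span_imp_monic_root:
  fixes hom :: "'a::comm_ring_1 \<Rightarrow> 'b::field"
  assumes hom: "comm_ring_hom hom"
    and fin: "finite S" and nz: "s \<in> S" "s \<noteq> 0"
    and stable: "\<And>s. s \<in> S \<Longrightarrow> \<exists>c. x * s = (\<Sum>t\<in>S. hom (c t) * t)"
  shows "\<exists>q. Polynomial.lead_coeff q = 1 \<and> poly (map_poly hom q) x = 0"
proof -
  interpret comm_ring_hom hom by (fact hom)
  from stable obtain c where c: "\<And>s. s \<in> S \<Longrightarrow> x * s = (\<Sum>t\<in>S. hom (c s t) * t)"
    by metis
  define n where "n = card S"
  obtain e where e: "bij_betw e {0..<n} S"
    using ex_bij_betw_nat_finite[OF fin] by (auto simp: n_def)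
  define A where "A = mat n n (\<lambda>(i,j). c (e i) (e j))"
  define v where "v = Matrix.vec n e"
  have A: "A \<in> carrier_mat n n" by (simp add: A_def)
  have "v \<noteq> 0\<^sub>v n"
  proof
    assume *: "v = 0\<^sub>v n"
    obtain i where i: "i < n" "e i = s"
      using e nz by (auto simp: bij_betw_def)
    have "Matrix.vec_index v i = 0" using * i by simp
    thus False using i nz by (simp add: v_def)
  qed
  moreover have "map_mat hom A *\<^sub>v v = x \<cdot>\<^sub>v v"
  proof (rule eq_vecI)
    fix i assume "i < dim_vec (x \<cdot>\<^sub>v v)"
    hence i: "i < n" by (simp add: v_def)
    hence ei: "e i \<in> S" using e by (auto simp: bij_betw_def)
    have "Matrix.vec_index (map_mat hom A *\<^sub>v v) i = (\<Sum>j = 0..<n. hom (c (e i) (e j)) * e j)"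
      using i by (simp add: A_def v_def scalar_prod_def)
    also have "\<dots> = (\<Sum>t\<in>S. hom (c (e i) t) * t)"
      by (rule sum.reindex_bij_betw[OF e])
    also have "\<dots> = x * e i" using c[OF ei] by simp
    finally show "Matrix.vec_index (map_mat hom A *\<^sub>v v) i = Matrix.vec_index (x \<cdot>\<^sub>v v) i"
      using i by (simp add: v_def)
  qed (simp add: A_def v_def)
  ultimately have "eigenvalue (map_mat hom A) x"
    unfolding eigenvalue_def eigenvector_def by (intro exI[of _ v]) (simp add: A_def v_def)
  hence "poly (char_poly (map_mat hom A)) x = 0"
    using eigenvalue_root_char_poly[of "map_mat hom A" n x] A by simp
  hence "poly (map_poly hom (char_poly A)) x = 0"
    by (simp add: char_poly_hom[OF A])
  moreover have "Polynomial.lead_coeff (char_poly A) = 1"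
    using degree_monic_char_poly[OF A] by auto
  ultimately show ?thesis by blast
qed

text \<open>Here \<open>int_mod.span S\<close> is the additive group generated by S.\<close>

interpretation int_mod: Modules.module "\<lambda>c (x::complex). of_int c * x"
  by unfold_locales (auto simp: algebra_simps)

lemma algebraic_int_if_int_stable:
  fixes x :: complex
  assumes "finite S" "s \<in> S" "s \<noteq> 0" "\<And>s. s \<in> S \<Longrightarrow> x * s \<in> int_mod.span S"
  shows "algebraic_int x"
proof -
  have "comm_ring_hom (of_int :: int \<Rightarrow> complex)"
    by unfold_locales auto
  from stable_span_imp_monic_root[OF this assms(1-3)] show ?thesis
    using assms(4) unfolding int_mod.span_finite[OF assms(1)] algebraic_int_altdef_ipoly by blast
qed

text \<open>The monic integral equation of x is solved for its leading term.\<close>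

lemma algebraic_int_power_in_span:
  fixes x :: complex
  assumes "algebraic_int x"
  obtains n where "n > 0" "x ^ n \<in> int_mod.span ((^) x ` {..<n})"
proof -
  from assms obtain q where q: "poly (map_poly of_int q) x = 0" "Polynomial.lead_coeff q = 1"
    unfolding algebraic_int_altdef_ipoly by blast
  define n where "n = Polynomial.degree q"
  have [simp]: "Polynomial.degree (map_poly of_int q :: complex poly) = n"
    unfolding n_def by (rule degree_map_poly) auto
  have *: "(\<Sum>i\<le>n. of_int (Polynomial.coeff q i) * x ^ i) = 0"
    using q(1) by (simp add: poly_altdef coeff_map_poly flip: n_def)
  \<comment> \<open>In degree 0 the monic polynomial is 1, which has no root. Positivity of n later
    puts \<open>x ^ 0 = 1\<close> among the generators.\<close>
  have "n > 0"
    using * q(2) by (cases "n = 0") (auto simp: n_def)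
  moreover have "x ^ n = - (\<Sum>i<n. of_int (Polynomial.coeff q i) * x ^ i)"
    using * q(2) by (simp add: n_def lessThan_Suc_atMost [symmetric] eq_neg_iff_add_eq_0 add.commute)
  hence "x ^ n \<in> int_mod.span ((^) x ` {..<n})"
    by simp (rule int_mod.span_neg, rule int_mod.span_sum, rule int_mod.span_scale,
             rule int_mod.span_base, auto)
  ultimately show thesis by (rule that)
qed

text \<open>Multiplication by y is additive, so generators suffice.\<close>

lemma int_span_mult:
  assumes "x \<in> int_mod.span S" "\<And>s. s \<in> S \<Longrightarrow> y * s \<in> int_mod.span T"
  shows "y * x \<in> int_mod.span T"
  using assms(1)
proof (induction rule: int_mod.span_induct_alt)
  case base
  show ?case by (simp add: int_mod.span_zero)
next
  case (step c s z)
  have "y * (of_int c * s + z) = of_int c * (y * s) + y * z"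
    by (simp add: algebra_simps)
  thus ?case
    using step assms(2) by (auto intro!: int_mod.span_add int_mod.span_scale)
qed

lemma mult_power_in_span:
  fixes x :: complex
  assumes "x ^ n \<in> int_mod.span ((^) x ` {..<n})" "i < n"
  shows "x * x ^ i \<in> int_mod.span ((^) x ` {..<n})"
proof (cases "Suc i < n")
  case True
  thus ?thesis
    by (intro int_mod.span_base) (auto simp flip: power_Suc)
next
  case False
  hence "n = Suc i" using assms by simp
  thus ?thesis using assms by simp
qed

text \<open>The monomials \<open>x ^ i * y ^ j\<close> below the degrees of the two integral
  equations generate a group stable under x and under y, hence under their sum and product.\<close>

lemma algebraic_int_add_mult:
  fixes x y :: complex
  assumes "algebraic_int x" "algebraic_int y"
  shows "algebraic_int (x + y)" "algebraic_int (x * y)"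
proof -
  from assms(1) obtain m where m: "m > 0" "x ^ m \<in> int_mod.span ((^) x ` {..<m})"
    by (rule algebraic_int_power_in_span)
  from assms(2) obtain n where n: "n > 0" "y ^ n \<in> int_mod.span ((^) y ` {..<n})"
    by (rule algebraic_int_power_in_span)
  define S where "S = (\<lambda>(i,j). x ^ i * y ^ j) ` ({..<m} \<times> {..<n})"
  have fin: "finite S" by (simp add: S_def)
  have one: "1 \<in> S" unfolding S_def using m n by (auto intro!: rev_image_eqI[of "(0,0)"])
  have memS: "x ^ i * y ^ j \<in> S" if "i < m" "j < n" for i j
    unfolding S_def using that by auto
  have xS: "x * s \<in> int_mod.span S" if "s \<in> S" for s
  proof -
    from that obtain i j where ij: "i < m" "j < n" "s = x ^ i * y ^ j" by (auto simp: S_def)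
    \<comment> \<open>Only the power of x is reduced; the factor \<open>y ^ j\<close> is carried
      along and keeps every resulting monomial in S.\<close>
    have "y ^ j * (x * x ^ i) \<in> int_mod.span S"
      by (rule int_span_mult[OF mult_power_in_span[OF m(2) ij(1)]])
         (use ij memS in \<open>auto intro!: int_mod.span_base simp: mult.commute[of "y ^ j"]\<close>)
    thus ?thesis using ij by (simp add: mult_ac)
  qed
  have yS: "y * s \<in> int_mod.span S" if "s \<in> S" for s
  proof -
    from that obtain i j where ij: "i < m" "j < n" "s = x ^ i * y ^ j" by (auto simp: S_def)
    have "x ^ i * (y * y ^ j) \<in> int_mod.span S"
      by (rule int_span_mult[OF mult_power_in_span[OF n(2) ij(2)]])
         (use ij memS in \<open>auto intro!: int_mod.span_base\<close>)
    thus ?thesis using ij by (simp add: mult_ac)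
  qed
  show "algebraic_int (x + y)"
    by (rule algebraic_int_if_int_stable[OF fin one])
       (auto simp: distrib_right intro!: int_mod.span_add xS yS)
  have "x * y * s \<in> int_mod.span S" if "s \<in> S" for s
    using int_span_mult[OF yS[OF that], of x S] xS by (simp add: mult.assoc)
  thus "algebraic_int (x * y)"
    by (intro algebraic_int_if_int_stable[OF fin one]) auto
qed

lemma algebraic_int_power:
  fixes x :: complex
  assumes "algebraic_int x"
  shows "algebraic_int (x ^ n)"
  by (induction n) (auto intro: algebraic_int_add_mult assms)

lemma algebraic_int_sum:
  fixes f :: "'a \<Rightarrow> complex"
  assumes "\<And>i. i \<in> A \<Longrightarrow> algebraic_int (f i)"
  shows "algebraic_int (sum f A)"
  using assms by (induction A rule: infinite_finite_induct) (auto intro: algebraic_int_add_mult)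

lemma algebraic_int_prod:
  fixes f :: "'a \<Rightarrow> complex"
  assumes "\<And>i. i \<in> A \<Longrightarrow> algebraic_int (f i)"
  shows "algebraic_int (prod f A)"
  using assms by (induction A rule: infinite_finite_induct) (auto intro: algebraic_int_add_mult)

text \<open>Pigeonhole: all powers of x are integral combinations of finitely many of them, and
  coefficient vectors modulo p take finitely many values.\<close>

lemma algebraic_int_powers_congruent:
  fixes x :: complex and p :: nat
  assumes "algebraic_int x" "p > 0"
  obtains i j where "i < j" "algebraic_int ((x ^ j - x ^ i) / of_nat p)"
proof -
  from assms(1) obtain n where n: "n > 0" "x ^ n \<in> int_mod.span ((^) x ` {..<n})"
    by (rule algebraic_int_power_in_span)
  define S where "S = (^) x ` {..<n}"
  have fin: "finite S" by (simp add: S_def)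
  have "x ^ k \<in> int_mod.span S" for k
  proof (induction k)
    case 0
    thus ?case using n by (auto simp: S_def intro!: int_mod.span_base rev_image_eqI[of 0])
  next
    case (Suc k)
    thus ?case using mult_power_in_span[OF n(2)] int_span_mult[OF Suc, of x S]
      by (auto simp: S_def)
  qed
  hence "\<exists>u. x ^ k = (\<Sum>s\<in>S. of_int (u s) * s)" for k
    unfolding int_mod.span_finite[OF fin] by blast
  then obtain u where u: "\<And>k. x ^ k = (\<Sum>s\<in>S. of_int (u k s) * s)" by metis
  \<comment> \<open>The coefficients of \<open>x ^ k\<close> reduced modulo p. Restricting to S
    makes r take values in a finite function space.\<close>
  define r where "r = (\<lambda>k. restrict (\<lambda>s. u k s mod int p) S)"
  have "range r \<subseteq> S \<rightarrow>\<^sub>E {0..<int p}"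
    using assms by (auto simp: r_def)
  moreover have "finite (S \<rightarrow>\<^sub>E {0..<int p})"
    by (intro finite_PiE fin) auto
  ultimately have "\<not> inj r"
    using finite_subset range_inj_infinite by blast
  then obtain i j where ij: "i < j" "r i = r j"
    unfolding inj_def by (metis linorder_neqE_nat)
  have "int p dvd u j s - u i s" if "s \<in> S" for s
    using fun_cong[OF ij(2), of s] that by (simp add: r_def mod_eq_dvd_iff dvd_diff_commute)
  then obtain d where d: "\<And>s. s \<in> S \<Longrightarrow> u j s - u i s = int p * d s"
    unfolding dvd_def by metis
  have "x ^ j - x ^ i = (\<Sum>s\<in>S. of_int (u j s - u i s) * s)"
    unfolding u[of j] u[of i] by (simp add: sum_subtractf algebra_simps)
  also have "\<dots> = of_nat p * (\<Sum>s\<in>S. of_int (d s) * s)"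
    unfolding sum_distrib_left by (intro sum.cong) (auto simp: d mult.assoc)
  finally have "(x ^ j - x ^ i) / of_nat p = (\<Sum>s\<in>S. of_int (d s) * s)"
    using assms by simp
  moreover have "algebraic_int (\<Sum>s\<in>S. of_int (d s) * s)"
    by (rule algebraic_int_sum, rule algebraic_int_add_mult(2))
       (auto simp: S_def intro: algebraic_int_power assms int_imp_algebraic_int)
  ultimately show thesis using that ij by simp
qed

section \<open>Conjugates and norms in Galois number fields\<close>

lemma complex_ring_simps [simp]:
  "carrier complex_ring = UNIV"
  "mult complex_ring = (*)" "add complex_ring = (+)"
  "one complex_ring = 1" "zero complex_ring = 0"
  by (simp_all add: ring_of_type_algebra_def)

interpretation CR: cring complex_ring
  by (rule cring_from_type_algebra)

lemma complex_ring_a_inv [simp]: "a_inv complex_ring x = - x"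
  using CR.minus_equality[of "- x" x] by simp

lemma complex_ring_m_inv: "x \<noteq> 0 \<Longrightarrow> m_inv complex_ring x = inverse x"
  using CR.inv_unique'[of x "inverse x"] by simp

interpretation rat_mod: Modules.module "\<lambda>c (x::complex). of_rat c * x"
  by unfold_locales (auto simp: algebra_simps of_rat_add of_rat_mult)

locale galois_number_field =
  fixes K :: "complex set"
  assumes galois: "finite_galois K"
begin

lemma subfield_K: "subfield K complex_ring"
  using galois by (simp add: finite_galois_def)

lemma K_closed [simp, intro]:
  "0 \<in> K" "1 \<in> K"
  "x \<in> K \<Longrightarrow> y \<in> K \<Longrightarrow> x + y \<in> K"
  "x \<in> K \<Longrightarrow> y \<in> K \<Longrightarrow> x * y \<in> K"
  "x \<in> K \<Longrightarrow> - x \<in> K"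
  using CR.subring_props[OF subfield_K] by auto

lemma K_diff [simp, intro]: "x \<in> K \<Longrightarrow> y \<in> K \<Longrightarrow> x - y \<in> K"
  using K_closed(3)[of x "- y"] by simp

lemma K_inverse [simp, intro]: "x \<in> K \<Longrightarrow> inverse x \<in> K"
  using CR.subfield_m_inv(1)[OF subfield_K, of x] complex_ring_m_inv[of x]
  by (cases "x = 0") auto

lemma K_divide [simp, intro]: "x \<in> K \<Longrightarrow> y \<in> K \<Longrightarrow> x / y \<in> K"
  by (simp add: divide_inverse)

lemma K_of_nat [simp, intro]: "of_nat n \<in> K"
  by (induction n) auto

lemma K_of_int [simp, intro]: "of_int n \<in> K"
  by (cases n rule: int_cases2) auto

lemma K_of_rat [simp, intro]: "of_rat q \<in> K"
  by (cases q) (auto simp: of_rat_rat)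

lemma K_power [simp, intro]: "x \<in> K \<Longrightarrow> x ^ n \<in> K"
  by (induction n) auto

lemma K_sum: "(\<And>i. i \<in> A \<Longrightarrow> f i \<in> K) \<Longrightarrow> sum f A \<in> K"
  by (induction A rule: infinite_finite_induct) auto

lemma K_prod: "(\<And>i. i \<in> A \<Longrightarrow> f i \<in> K) \<Longrightarrow> prod f A \<in> K"
  by (induction A rule: infinite_finite_induct) auto

text \<open>Translates the record-based ring isomorphisms into ordinary complex arithmetic.\<close>

lemma galois_iff:
  "\<sigma> \<in> galois_group K \<longleftrightarrow>
     \<sigma> \<in> extensional K \<and> bij_betw \<sigma> K K \<and>
     (\<forall>x\<in>K. \<forall>y\<in>K. \<sigma> (x * y) = \<sigma> x * \<sigma> y \<and> \<sigma> (x + y) = \<sigma> x + \<sigma> y) \<and>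
     \<sigma> 1 = 1 \<and> (\<forall>x\<in>\<rat>. \<sigma> x = x)"
  unfolding galois_group_def ring_iso_def Ring.ring_hom_def by (auto simp: bij_betw_def)

section \<open>Automorphisms and polynomial equations\<close>

context
  fixes \<sigma> assumes \<sigma>: "\<sigma> \<in> galois_group K"
begin

lemma galois_bij: "bij_betw \<sigma> K K"
  using \<sigma> by (simp add: galois_iff)

lemma galois_closed: "x \<in> K \<Longrightarrow> \<sigma> x \<in> K"
  using galois_bij by (auto simp: bij_betw_def)

lemma galois_hom:
  "x \<in> K \<Longrightarrow> y \<in> K \<Longrightarrow> \<sigma> (x + y) = \<sigma> x + \<sigma> y"
  "x \<in> K \<Longrightarrow> y \<in> K \<Longrightarrow> \<sigma> (x * y) = \<sigma> x * \<sigma> y"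
  "\<sigma> 1 = 1"
  using \<sigma> by (auto simp: galois_iff)

lemma galois_rat: "\<sigma> (of_rat q) = of_rat q" "\<sigma> (of_int m) = of_int m" "\<sigma> (of_nat n) = of_nat n"
  "\<sigma> 0 = 0"
  using \<sigma> by (auto simp: galois_iff)

lemma galois_eq_0_iff: "x \<in> K \<Longrightarrow> \<sigma> x = 0 \<longleftrightarrow> x = 0"
  using galois_bij galois_rat(4) by (metis K_closed(1) bij_betw_def inj_onD)

lemma galois_diff: "x \<in> K \<Longrightarrow> y \<in> K \<Longrightarrow> \<sigma> (x - y) = \<sigma> x - \<sigma> y"
  using galois_hom(1)[of "x - y" y] by simp

lemma galois_power: "x \<in> K \<Longrightarrow> \<sigma> (x ^ n) = \<sigma> x ^ n"
  by (induction n) (auto simp: galois_hom)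

lemma galois_sum: "(\<And>i. i \<in> A \<Longrightarrow> f i \<in> K) \<Longrightarrow> \<sigma> (sum f A) = (\<Sum>i\<in>A. \<sigma> (f i))"
  by (induction A rule: infinite_finite_induct) (auto simp: galois_hom galois_rat K_sum)

lemma galois_prod: "(\<And>i. i \<in> A \<Longrightarrow> f i \<in> K) \<Longrightarrow> \<sigma> (prod f A) = (\<Prod>i\<in>A. \<sigma> (f i))"
  by (induction A rule: infinite_finite_induct) (auto simp: galois_hom galois_rat K_prod)

lemma galois_poly:
  assumes "x \<in> K"
  shows "\<sigma> (poly (map_poly of_rat q) x) = poly (map_poly of_rat q) (\<sigma> x)"
    and "\<sigma> (poly (map_poly of_int r) x) = poly (map_poly of_int r) (\<sigma> x)"
  using assms
  by (simp_all add: poly_altdef galois_sum galois_hom galois_power galois_rat coeff_map_poly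
        degree_map_poly)

text \<open>A conjugate satisfies the same monic integral equation.\<close>

lemma galois_algebraic_int:
  assumes "x \<in> K" "algebraic_int x"
  shows "algebraic_int (\<sigma> x)"
proof -
  from assms obtain r where "poly (map_poly of_int r) x = 0" "Polynomial.lead_coeff r = 1"
    unfolding algebraic_int_altdef_ipoly by blast
  thus ?thesis
    unfolding algebraic_int_altdef_ipoly
    using galois_poly(2)[OF assms(1), of r] galois_rat by auto
qed

end

section \<open>Finiteness of the extension and of its Galois group\<close>

lemma finite_spanning_set:
  obtains B where "finite B" "B \<subseteq> K" "K \<subseteq> rat_mod.span B"
proof -
  have "CR.finite_dimension \<rat> K" using galois by (simp add: finite_galois_def)
  then obtain n where n: "CR.dimension n \<rat> K" by (auto simp: CR.finite_dimension_def)
  have Q: "subfield \<rat> complex_ring"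
  proof (rule field.subfieldI'[OF field_from_type_algebra])
    show "subring \<rat> complex_ring" by (rule CR.subringI) auto
    show "\<And>k. k \<in> \<rat> - {\<zero>\<^bsub>complex_ring\<^esub>} \<Longrightarrow> inv\<^bsub>complex_ring\<^esub> k \<in> \<rat>"
      by (auto simp: complex_ring_m_inv)
  qed
  from CR.exists_base[OF Q n] obtain Vs
    where Vs: "CR.Span \<rat> Vs = K" by blast
  \<comment> \<open>Passes from list-based linear combinations with rational coefficients to the
    span in \<open>rat_mod\<close>.\<close>
  have comb: "CR.combine Ks Us \<in> rat_mod.span (set Us)" if "set Ks \<subseteq> \<rat>" for Ks Us
    using that
  proof (induction Ks Us rule: CR.combine.induct)
    case (1 k Ks u Us)
    obtain q where q: "k = of_rat q" using 1 by (auto elim!: Rats_cases)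
    have "CR.combine Ks Us \<in> rat_mod.span (set (u # Us))"
      using 1 rat_mod.span_mono[of "set Us" "set (u # Us)"] by auto
    moreover have "k * u \<in> rat_mod.span (set (u # Us))"
      unfolding q by (rule rat_mod.span_scale, rule rat_mod.span_base) auto
    ultimately show ?case
      by (auto intro: rat_mod.span_add)
  qed (auto simp: rat_mod.span_zero)
  have "K \<subseteq> rat_mod.span (set Vs)"
    unfolding Vs[symmetric] using CR.Span_eq_combine_set[OF Q, of Vs] comb
    by (auto simp del: CR.Span.simps)
  moreover have "set Vs \<subseteq> K"
    using CR.Span_base_incl[OF Q, of Vs] Vs by auto
  ultimately show thesis using that[of "set Vs"] by auto
qed

text \<open>Multiplication by x preserves K, which has a finite spanning set over the rationals, so
  the determinant trick applies.\<close>

lemma K_algebraic: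
  assumes "x \<in> K"
  shows "\<exists>q. q \<noteq> 0 \<and> poly (map_poly of_rat q) x = 0"
proof -
  obtain B where B: "finite B" "B \<subseteq> K" "K \<subseteq> rat_mod.span B" by (rule finite_spanning_set)
  \<comment> \<open>If all generators were 0, their span could not contain 1.\<close>
  have "\<exists>s\<in>B. s \<noteq> 0"
  proof (rule ccontr)
    assume "\<not> (\<exists>s\<in>B. s \<noteq> 0)"
    hence zero: "b = 0" if "b \<in> B" for b using that by blast
    have "1 \<in> rat_mod.span B" using B by blast
    then obtain u where "1 = (\<Sum>b\<in>B. of_rat (u b) * b)"
      unfolding rat_mod.span_finite[OF B(1)] by blast
    also have "\<dots> = 0" by (rule sum.neutral) (auto dest: zero)
    finally show False by simp
  qed
  then obtain s where s: "s \<in> B" "s \<noteq> 0" by blast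
  have "comm_ring_hom (of_rat :: rat \<Rightarrow> complex)"
    by unfold_locales (auto simp: of_rat_add of_rat_mult)
  from stable_span_imp_monic_root[OF this B(1) s, of x]
  have "\<exists>q. Polynomial.lead_coeff q = 1 \<and> poly (map_poly of_rat q) x = 0"
    using B assms unfolding rat_mod.span_finite[OF B(1)] by blast
  thus ?thesis by (metis leading_coeff_0_iff zero_neq_one)
qed

text \<open>An automorphism is determined by its values on a finite spanning set, and each value is
  among the finitely many roots of a fixed rational polynomial.\<close>

lemma finite_galois_group: "finite (galois_group K)"
proof -
  obtain B where B: "finite B" "B \<subseteq> K" "K \<subseteq> rat_mod.span B" by (rule finite_spanning_set)
  have "\<forall>b\<in>B. \<exists>q. q \<noteq> 0 \<and> poly (map_poly of_rat q) b = 0"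
    using K_algebraic B by blast
  then obtain q where q: "\<And>b. b \<in> B \<Longrightarrow> q b \<noteq> 0"
    "\<And>b. b \<in> B \<Longrightarrow> poly (map_poly of_rat (q b)) b = 0" by metis
  define R where "R = (\<lambda>b. {z::complex. poly (map_poly of_rat (q b)) z = 0})"
  have "(\<lambda>\<sigma>. restrict \<sigma> B) ` galois_group K \<subseteq> (\<Pi>\<^sub>E b\<in>B. R b)"
  proof safe
    fix \<sigma> b assume \<sigma>: "\<sigma> \<in> galois_group K" and b: "b \<in> B"
    thus "restrict \<sigma> B b \<in> R b"
      using galois_poly(1)[OF \<sigma>, of b "q b"] q(2)[OF b] galois_rat(4)[OF \<sigma>] B by (auto simp: R_def)
  qed auto
  moreover have "finite (\<Pi>\<^sub>E b\<in>B. R b)"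
  proof (intro finite_PiE B)
    fix b assume "b \<in> B"
    hence "map_poly of_rat (q b) \<noteq> (0 :: complex poly)"
      using q(1) by (auto simp: poly_eq_iff coeff_map_poly)
    thus "finite (R b)" unfolding R_def by (rule poly_roots_finite)
  qed
  moreover have "inj_on (\<lambda>\<sigma>. restrict \<sigma> B) (galois_group K)"
  proof (rule inj_onI)
    fix \<sigma> \<tau> assume st: "\<sigma> \<in> galois_group K" "\<tau> \<in> galois_group K" "restrict \<sigma> B = restrict \<tau> B"
    have eq: "\<sigma> b = \<tau> b" if "b \<in> B" for b
      using fun_cong[OF st(3), of b] that by simp
    show "\<sigma> = \<tau>"
    proof (rule extensionalityI[of _ K])
      fix x assume "x \<in> K"
      then obtain u where x: "x = (\<Sum>b\<in>B. of_rat (u b) * b)"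
        using B(3) unfolding rat_mod.span_finite[OF B(1)] by blast
      have "\<rho> x = (\<Sum>b\<in>B. of_rat (u b) * \<rho> b)" if "\<rho> \<in> galois_group K" for \<rho>
        unfolding x using that B(2)
        by (subst galois_sum[OF that]) (auto intro!: sum.cong simp: galois_hom galois_rat subset_iff)
      hence "\<sigma> x = (\<Sum>b\<in>B. of_rat (u b) * \<sigma> b)" "\<tau> x = (\<Sum>b\<in>B. of_rat (u b) * \<tau> b)"
        using st by blast+
      thus "\<sigma> x = \<tau> x" using eq by simp
    qed (use st in \<open>auto simp: galois_iff\<close>)
  qed
  ultimately show ?thesis
    by (meson finite_imageD finite_subset)
qed

section \<open>Composition of automorphisms and the norm\<close>

lemma galois_id: "restrict id K \<in> galois_group K"
  by (auto simp: galois_iff bij_betw_def inj_on_def elim!: Rats_cases)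

lemma galois_compose:
  assumes "\<sigma> \<in> galois_group K" "\<tau> \<in> galois_group K"
  shows "compose K \<sigma> \<tau> \<in> galois_group K"
proof -
  \<comment> \<open>\<open>compose K\<close> is meaningful only on K, so fixing the rationals
    requires that they lie there.\<close>
  have "q \<in> K" if "q \<in> \<rat>" for q :: complex
    using that by (auto simp: Rats_def)
  moreover have "bij_betw (compose K \<sigma> \<tau>) K K"
    using bij_betw_compose assms galois_bij by blast
  ultimately show ?thesis
    using galois_hom[OF assms(1)] galois_hom[OF assms(2)] galois_closed[OF assms(2)]
      assms[unfolded galois_iff]
    unfolding galois_iff by (auto simp: compose_def)
qed

text \<open>If all conjugates were smaller than 1, so would be the norm N. But N is fixed by the
  group, hence rational by the Galois hypothesis, and a rational algebraic integer is an integer;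
  being nonzero, it has absolute value at least 1.\<close>

lemma exists_large_conjugate:
  assumes x: "x \<in> ring_of_integers K" "x \<noteq> 0"
  shows "\<exists>\<sigma>\<in>galois_group K. cmod (\<sigma> x) \<ge> 1"
proof (rule ccontr)
  assume "\<not> ?thesis"
  hence small: "cmod (\<sigma> x) < 1" if "\<sigma> \<in> galois_group K" for \<sigma>
    using that by auto
  from x have xK: "x \<in> K" "algebraic_int x" by (auto simp: ring_of_integers_def)
  have conj: "\<sigma> x \<in> K" if "\<sigma> \<in> galois_group K" for \<sigma>
    using galois_closed[OF that xK(1)] .
  define N where "N = (\<Prod>\<sigma>\<in>galois_group K. \<sigma> x)"
  have NK: "N \<in> K"
    unfolding N_def by (rule K_prod) (rule conj)
  have "\<tau> N = N" if \<tau>: "\<tau> \<in> galois_group K" for \<tau>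
  proof -
    have inj: "inj_on (compose K \<tau>) (galois_group K)"
    proof (rule inj_onI)
      fix \<sigma> \<rho> assume *: "\<sigma> \<in> galois_group K" "\<rho> \<in> galois_group K" "compose K \<tau> \<sigma> = compose K \<tau> \<rho>"
      show "\<sigma> = \<rho>"
      proof (rule extensionalityI[of _ K])
        fix y assume y: "y \<in> K"
        have "\<tau> (\<sigma> y) = \<tau> (\<rho> y)"
          using fun_cong[OF *(3), of y] y by (simp add: compose_def)
        thus "\<sigma> y = \<rho> y"
          using inj_onD[OF bij_betw_imp_inj_on[OF galois_bij[OF \<tau>]]]
            galois_closed[OF *(1) y] galois_closed[OF *(2) y] by blast
      qed (use * in \<open>auto simp: galois_iff\<close>)
    qed
    \<comment> \<open>On a finite set injectivity suffices, so composing with \<tau> only permutes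
      the factors of N.\<close>
    have bij: "bij_betw (compose K \<tau>) (galois_group K) (galois_group K)"
      unfolding bij_betw_def
      using inj endo_inj_surj[OF finite_galois_group _ inj] galois_compose[OF \<tau>] by blast
    have "\<tau> N = (\<Prod>\<sigma>\<in>galois_group K. \<tau> (\<sigma> x))"
      unfolding N_def by (rule galois_prod[OF \<tau>]) (rule conj)
    also have "\<dots> = (\<Prod>\<sigma>\<in>galois_group K. compose K \<tau> \<sigma> x)"
      using xK by (simp add: compose_def)
    also have "\<dots> = N"
      unfolding N_def by (rule prod.reindex_bij_betw[OF bij])
    finally show ?thesis .
  qed
  hence "N \<in> \<rat>"
    using NK galois unfolding finite_galois_def by blast
  moreover have "algebraic_int N"
    unfolding N_def by (rule algebraic_int_prod) (rule galois_algebraic_int[OF _ xK])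
  ultimately have "N \<in> \<int>"
    by (intro rational_algebraic_int_is_int)
  moreover have "N \<noteq> 0"
    unfolding N_def using finite_galois_group galois_eq_0_iff xK x by auto
  ultimately have "cmod N \<ge> 1"
    by (auto elim!: Ints_cases)
  moreover have "cmod N < 1"
  proof -
    have "cmod N = (\<Prod>\<sigma>\<in>galois_group K. cmod (\<sigma> x))"
      by (simp add: N_def prod_norm)
    \<comment> \<open>The identity factor is split off to obtain a strict inequality; the remaining
      product is merely bounded by 1.\<close>
    also have "\<dots> = cmod (restrict id K x) * (\<Prod>\<sigma>\<in>galois_group K - {restrict id K}. cmod (\<sigma> x))"
      by (rule prod.remove[OF finite_galois_group galois_id])
    also have "\<dots> \<le> cmod (restrict id K x) * 1"
      by (intro mult_left_mono prod_le_1) (auto intro: less_imp_le small)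
    also have "\<dots> < 1" using small[OF galois_id] by simp
    finally show ?thesis .
  qed
  ultimately show False by simp
qed

lemma max_conjugate_ge:
  assumes "\<sigma> \<in> galois_group K"
  shows "cmod (\<sigma> x) \<le> max_conjugate K x"
  unfolding max_conjugate_def using assms finite_galois_group by (intro Max_ge) auto

end

section \<open>Localization at a rational prime\<close>

text \<open>Zorn's lemma on the ideals containing I and avoiding 1: avoiding 1 expresses properness
  in a form that passes to unions of chains.\<close>

lemma (in cring) exists_maximalideal_above:
  assumes I: "ideal I R" "I \<noteq> carrier R"
  obtains M where "maximalideal M R" "I \<subseteq> M"
proof -
  define A where "A = {J. ideal J R \<and> I \<subseteq> J \<and> \<one> \<notin> J}"
  have "I \<in> A"
    using I ideal.one_imp_carrier[OF I(1)] by (auto simp: A_def)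
  have "\<exists>M\<in>A. \<forall>J\<in>A. M \<subseteq> J \<longrightarrow> J = M"
  proof (rule subset_Zorn_nonempty)
    show "A \<noteq> {}" using \<open>I \<in> A\<close> by auto
    fix C assume C: "C \<noteq> {}" "subset.chain A C"
    hence sub: "C \<subseteq> A" and "subset.chain {J. ideal J R} C"
      by (auto simp: A_def pred_on.chain_def)
    hence "ideal (\<Union>C) R"
      using chain_Union_is_ideal[of C] C by simp
    thus "\<Union>C \<in> A"
      using sub C(1) by (auto simp: A_def)
  qed
  then obtain M where M: "M \<in> A" "\<And>J. J \<in> A \<Longrightarrow> M \<subseteq> J \<Longrightarrow> J = M" by blast
  have "maximalideal M R"
  proof (rule maximalidealI)
    show "ideal M R" "carrier R \<noteq> M" using M by (auto simp: A_def)
    fix J assume J: "ideal J R" "M \<subseteq> J" "J \<subseteq> carrier R"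
    show "J = M \<or> J = carrier R"
    proof (cases "\<one> \<in> J")
      case True
      thus ?thesis using ideal.one_imp_carrier[OF J(1)] by simp
    next
      case False
      hence "J \<in> A" using J M by (auto simp: A_def)
      thus ?thesis using M(2) J by blast
    qed
  qed
  thus thesis using that M by (auto simp: A_def)
qed

lemma cring_of_subring: "subring H complex_ring \<Longrightarrow> cring (complex_ring\<lparr>carrier := H\<rparr>)"
  using CR.subcringI' CR.subcring_iff[of H] by auto

context galois_number_field
begin

lemma integers_subset: "x \<in> ring_of_integers K \<Longrightarrow> x \<in> K"
  by (simp add: ring_of_integers_def)

lemma integers_closed [simp, intro]:
  "0 \<in> ring_of_integers K" "1 \<in> ring_of_integers K"
  "x \<in> ring_of_integers K \<Longrightarrow> y \<in> ring_of_integers K \<Longrightarrow> x + y \<in> ring_of_integers K"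
  "x \<in> ring_of_integers K \<Longrightarrow> y \<in> ring_of_integers K \<Longrightarrow> x * y \<in> ring_of_integers K"
  "x \<in> ring_of_integers K \<Longrightarrow> - x \<in> ring_of_integers K"
  "of_nat n \<in> ring_of_integers K" "of_int m \<in> ring_of_integers K"
  by (auto simp: ring_of_integers_def algebraic_int_add_mult int_imp_algebraic_int)

lemma integers_power [simp, intro]:
  "x \<in> ring_of_integers K \<Longrightarrow> x ^ n \<in> ring_of_integers K"
  by (induction n) auto

lemma roots_of_unity_integer: "\<zeta> \<in> roots_of_unity K \<Longrightarrow> \<zeta> \<in> ring_of_integers K"
proof -
  assume "\<zeta> \<in> roots_of_unity K"
  then obtain n :: nat where n: "\<zeta> \<in> K" "n > 0" "\<zeta> ^ n = 1"
    by (auto simp: roots_of_unity_def)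
  have "algebraic_int \<zeta>"
  proof (rule algebraic_int_root)
    show "poly (Polynomial.monom 1 n) \<zeta> = 1" using n by (simp add: poly_monom)
    show "algebraic_int (1::complex)" by simp
  qed (use n in \<open>auto simp: Polynomial.degree_monom_eq\<close>)
  thus ?thesis using n by (simp add: ring_of_integers_def)
qed

lemma roots_of_unity_closed:
  assumes "\<zeta> \<in> roots_of_unity K"
  shows "\<zeta> \<noteq> 0" "inverse \<zeta> \<in> roots_of_unity K"
    and "\<xi> \<in> roots_of_unity K \<Longrightarrow> \<zeta> * \<xi> \<in> roots_of_unity K"
proof -
  from assms obtain n :: nat where n: "\<zeta> \<in> K" "n > 0" "\<zeta> ^ n = 1"
    by (auto simp: roots_of_unity_def)
  show "\<zeta> \<noteq> 0" using n by (auto simp: power_0_left)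
  show "inverse \<zeta> \<in> roots_of_unity K"
    using n by (auto simp: roots_of_unity_def power_inverse intro!: exI[of _ n])
  assume "\<xi> \<in> roots_of_unity K"
  then obtain m :: nat where m: "\<xi> \<in> K" "m > 0" "\<xi> ^ m = 1"
    by (auto simp: roots_of_unity_def)
  have "(\<zeta> * \<xi>) ^ (n * m) = (\<zeta> ^ n) ^ m * (\<xi> ^ m) ^ n"
    by (simp add: power_mult_distrib mult.commute flip: power_mult)
  thus "\<zeta> * \<xi> \<in> roots_of_unity K"
    using n m by (auto simp: roots_of_unity_def intro!: exI[of _ "n * m"])
qed

lemma one_root_of_unity: "1 \<in> roots_of_unity K"
  by (auto simp: roots_of_unity_def intro!: exI[of _ 1])

lemma subring_integers: "subring (ring_of_integers K) complex_ring"
  by (rule CR.subringI) auto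

lemmas cring_integers = cring_of_subring[OF subring_integers]

text \<open>The prime ideal axioms in terms of complex arithmetic; the last fact says that the
  complement of P is multiplicatively closed.\<close>

lemma primes_above_facts:
  assumes "P \<in> primes_above K p"
  shows "of_nat p \<in> P" "1 \<notin> P" "0 \<in> P" "P \<subseteq> ring_of_integers K"
    and "a \<in> P \<Longrightarrow> b \<in> P \<Longrightarrow> a + b \<in> P"
    and "a \<in> P \<Longrightarrow> b \<in> ring_of_integers K \<Longrightarrow> a * b \<in> P"
    and "a \<in> ring_of_integers K - P \<Longrightarrow> b \<in> ring_of_integers K - P \<Longrightarrow>
           a * b \<in> ring_of_integers K - P"
proof -
  let ?R = "complex_ring\<lparr>carrier := ring_of_integers K\<rparr>"
  from assms have P: "primeideal P ?R" and p: "of_nat p \<in> P"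
    by (auto simp: primes_above_def)
  interpret P: primeideal P ?R by (fact P)
  show "of_nat p \<in> P" by (fact p)
  show "1 \<notin> P" using P.one_imp_carrier P.I_notcarr by auto
  show "0 \<in> P" using additive_subgroup.zero_closed[OF P.is_additive_subgroup] by simp
  show "P \<subseteq> ring_of_integers K" using P.a_subset by simp
  show "a \<in> P \<Longrightarrow> b \<in> P \<Longrightarrow> a + b \<in> P" 
    using additive_subgroup.a_closed[OF P.is_additive_subgroup, of a b] by simp
  show "a \<in> P \<Longrightarrow> b \<in> ring_of_integers K \<Longrightarrow> a * b \<in> P" using P.I_r_closed[of a b] by simp
  show "a \<in> ring_of_integers K - P \<Longrightarrow> b \<in> ring_of_integers K - P \<Longrightarrow>
           a * b \<in> ring_of_integers K - P"
    using P.I_prime[of a b] by auto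
qed

lemma p_integersD: "x \<in> p_integers K p \<Longrightarrow> x \<in> K"
  by (simp add: p_integers_def)

text \<open>Otherwise the ideal of denominators of \<open>z\<close> lies in a maximal ideal, which contains \<open>p\<close>.\<close>

lemma integer_if_p_integer:
  assumes z: "z \<in> p_integers K p" and pz: "of_nat p * z \<in> ring_of_integers K"
  shows "z \<in> ring_of_integers K"
proof (rule ccontr)
  assume nz: "z \<notin> ring_of_integers K"
  let ?R = "complex_ring\<lparr>carrier := ring_of_integers K\<rparr>"
  interpret R: cring ?R by (rule cring_integers)
  define I where "I = {b \<in> ring_of_integers K. b * z \<in> ring_of_integers K}"
  have "ideal I ?R"
  proof (rule idealI[OF R.ring_axioms])
    show "subgroup I (add_monoid ?R)"
    proof (rule group.subgroupI[OF R.a_group])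
      show "I \<subseteq> carrier (add_monoid ?R)" by (auto simp: I_def)
      show "I \<noteq> {}" by (auto simp: I_def intro!: exI[of _ 0])
      fix a assume a: "a \<in> I"
      have "a_inv ?R a = - a"
        using R.minus_equality[of "- a" a] a by (simp add: I_def)
      thus "inv\<^bsub>add_monoid ?R\<^esub> a \<in> I"
        using a by (simp add: I_def a_inv_def)
      fix b assume "b \<in> I"
      thus "a \<otimes>\<^bsub>add_monoid ?R\<^esub> b \<in> I"
        using a by (simp add: I_def distrib_right)
    qed
  next
    fix a x assume "a \<in> I" "x \<in> carrier ?R"
    hence "x * a \<in> I" by (simp add: I_def mult.assoc)
    thus "x \<otimes>\<^bsub>?R\<^esub> a \<in> I" "a \<otimes>\<^bsub>?R\<^esub> x \<in> I" by (simp_all add: mult.commute)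
  qed
  moreover have "I \<noteq> carrier ?R"
  proof
    assume "I = carrier ?R"
    hence "1 \<in> I" by simp
    thus False using nz by (simp add: I_def)
  qed
  ultimately obtain M where M: "maximalideal M ?R" "I \<subseteq> M"
    by (rule R.exists_maximalideal_above)
  \<comment> \<open>By the hypothesis on \<open>of_nat p * z\<close>, p itself is a denominator of
    z.\<close>
  have "of_nat p \<in> M"
    using M pz by (auto simp: I_def)
  hence "M \<in> primes_above K p"
    using R.maximalideal_prime[OF M(1)] by (simp add: primes_above_def)
  \<comment> \<open>Integrality at M provides a denominator b outside M, although every denominator
    lies in I and hence in M.\<close>
  then obtain a b where ab: "a \<in> ring_of_integers K" "b \<in> ring_of_integers K - M" "z = a / b"
    using z by (auto simp: p_integers_def integral_at_def)
  have "0 \<in> M" using \<open>M \<in> primes_above K p\<close> by (rule primes_above_facts)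
  hence "b \<noteq> 0" using ab by auto
  hence "b \<in> I" using ab by (auto simp: I_def)
  thus False using M ab by auto
qed

section \<open>The ring of p-integers\<close>

lemma integral_at_integer:
  assumes "P \<in> primes_above K p" "x \<in> ring_of_integers K"
  shows "integral_at K P x"
  unfolding integral_at_def using primes_above_facts[OF assms(1)] assms(2)
  by (intro bexI[of _ x] bexI[of _ 1]) auto

lemma integers_subset_p_integers: "x \<in> ring_of_integers K \<Longrightarrow> x \<in> p_integers K p"
  using integral_at_integer by (auto simp: p_integers_def integers_subset)

lemma integral_at_add_mult:
  assumes P: "P \<in> primes_above K p" and "integral_at K P x" "integral_at K P y"
  shows "integral_at K P (x + y)" "integral_at K P (x * y)"
proof -
  from assms obtain a b c d where
    ab: "a \<in> ring_of_integers K" "b \<in> ring_of_integers K - P" "x = a / b" and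
    cd: "c \<in> ring_of_integers K" "d \<in> ring_of_integers K - P" "y = c / d"
    unfolding integral_at_def by blast
  note P' = primes_above_facts[OF P]
  have nz: "b \<noteq> 0" "d \<noteq> 0" using ab(2) cd(2) P'(3) by auto
  have bd: "b * d \<in> ring_of_integers K - P" by (rule P'(7)[OF ab(2) cd(2)])
  have "x + y = (a * d + c * b) / (b * d)" using ab cd nz by (simp add: field_simps)
  thus "integral_at K P (x + y)"
    unfolding integral_at_def
    by (intro bexI[OF _ bd] bexI[of _ "a * d + c * b"]) (use ab cd in auto)
  have "x * y = (a * c) / (b * d)" using ab cd by simp
  thus "integral_at K P (x * y)"
    unfolding integral_at_def by (intro bexI[OF _ bd] bexI[of _ "a * c"]) (use ab cd in auto)
qed

lemma p_integers_closed [simp, intro]: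
  "0 \<in> p_integers K p" "1 \<in> p_integers K p" "of_nat n \<in> p_integers K p"
  "x \<in> p_integers K p \<Longrightarrow> y \<in> p_integers K p \<Longrightarrow> x + y \<in> p_integers K p"
  "x \<in> p_integers K p \<Longrightarrow> y \<in> p_integers K p \<Longrightarrow> x * y \<in> p_integers K p"
proof -
  show "0 \<in> p_integers K p" "1 \<in> p_integers K p" "of_nat n \<in> p_integers K p"
    by (rule integers_subset_p_integers, simp)+
  assume "x \<in> p_integers K p" "y \<in> p_integers K p"
  thus "x + y \<in> p_integers K p" "x * y \<in> p_integers K p"
    by (simp_all add: p_integers_def integral_at_add_mult)
qed

lemma p_integers_uminus [simp, intro]: "x \<in> p_integers K p \<Longrightarrow> - x \<in> p_integers K p"
  using p_integers_closed(5)[of "- 1" p x] integers_subset_p_integers[of "- 1"] by simp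

lemma p_integers_diff [simp, intro]:
  "x \<in> p_integers K p \<Longrightarrow> y \<in> p_integers K p \<Longrightarrow> x - y \<in> p_integers K p"
  using p_integers_closed(4)[of x p "- y"] by simp

lemma p_integers_power [simp, intro]: "x \<in> p_integers K p \<Longrightarrow> x ^ n \<in> p_integers K p"
  by (induction n) auto

lemma subring_p_integers: "subring (p_integers K p) complex_ring"
  by (rule CR.subringI) auto

text \<open>Without primes above p, \<open>1 / p\<close> would vacuously be a p-integer, hence an
  algebraic integer by \<open>integer_if_p_integer\<close>, hence an ordinary integer.\<close>

lemma primes_above_nonempty:
  assumes "p > 1"
  shows "primes_above K p \<noteq> {}"
proof
  assume "primes_above K p = {}"
  hence "1 / of_nat p \<in> p_integers K p" by (simp add: p_integers_def)
  hence "1 / of_nat p \<in> ring_of_integers K"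
    by (rule integer_if_p_integer) (use assms in simp)
  hence "1 / of_nat p \<in> (\<int> :: complex set)"
    by (intro rational_algebraic_int_is_int) (auto simp: ring_of_integers_def)
  then obtain m where "1 / of_nat p = (of_int m :: complex)" by (auto elim: Ints_cases)
  hence "of_int (m * int p) = (of_int 1 :: complex)"
    using assms by (simp add: field_simps)
  hence "m * int p = 1" by (simp only: of_int_eq_iff)
  thus False using assms zmult_eq_1_iff[of m "int p"] by auto
qed

text \<open>With \<open>z = a / b\<close> at P, the element is \<open>(b + p * a) / b\<close>. Its
  numerator avoids P because b does while \<open>p * a\<close> lies in P.\<close>

lemma one_plus_p_unit:
  assumes "p > 1" "z \<in> p_integers K p"
  shows "1 + of_nat p * z \<noteq> 0" "inverse (1 + of_nat p * z) \<in> p_integers K p"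
proof -
  have *: "1 + of_nat p * z \<noteq> 0 \<and> integral_at K P (inverse (1 + of_nat p * z))"
    if P: "P \<in> primes_above K p" for P
  proof -
    note P' = primes_above_facts[OF P]
    obtain a b where ab: "a \<in> ring_of_integers K" "b \<in> ring_of_integers K - P" "z = a / b"
      using P assms unfolding integral_at_def p_integers_def by blast
    have "b \<noteq> 0" using ab(2) P'(3) by auto
    hence eq: "1 + of_nat p * z = (b + of_nat p * a) / b" using ab by (simp add: field_simps)
    have pa: "of_nat p * a \<in> P" by (rule P'(6)[OF P'(1) ab(1)])
    have "- (of_nat p * a) \<in> P" using P'(6)[OF pa, of "- 1"] by simp
    hence "b + of_nat p * a \<notin> P"
      using P'(5)[of "b + of_nat p * a" "- (of_nat p * a)"] ab by auto
    hence c: "b + of_nat p * a \<in> ring_of_integers K - P" using ab by auto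
    hence "b + of_nat p * a \<noteq> 0" using P'(3) by auto
    moreover have "inverse (1 + of_nat p * z) = b / (b + of_nat p * a)"
      unfolding eq by simp
    moreover have "b \<in> ring_of_integers K" using ab by simp
    ultimately show ?thesis
      unfolding integral_at_def using eq \<open>b \<noteq> 0\<close> c by (metis divide_eq_0_iff)
  qed
  \<comment> \<open>Nonvanishing was derived at a given prime, so some prime above p has to
    exist.\<close>
  show "1 + of_nat p * z \<noteq> 0"
    using * primes_above_nonempty[OF assms(1)] by blast
  show "inverse (1 + of_nat p * z) \<in> p_integers K p"
    using * assms p_integersD[OF assms(2)] by (auto simp: p_integers_def)
qed

section \<open>Units of the p-integers and powers congruent to 1\<close>

lemma prime_to_iff:
  "prime_to K p x \<longleftrightarrow> x \<noteq> 0 \<and> x \<in> p_integers K p \<and> inverse x \<in> p_integers K p"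
  by (auto simp: prime_to_def p_integers_def)

text \<open>By Bezout, a prime containing both p and n would contain 1.\<close>

lemma of_nat_coprime_unit:
  assumes "coprime p n"
  shows "inverse (of_nat n) \<in> p_integers K p"
proof -
  have "integral_at K P (inverse (of_nat n))" if P: "P \<in> primes_above K p" for P
  proof -
    note P' = primes_above_facts[OF P]
    obtain u v where uv: "u * int p + v * int n = 1"
      using assms bezout_int[of "int p" "int n"] by auto
    have "of_nat n \<notin> P"
    proof
      assume n: "of_nat n \<in> P"
      have "of_nat p * of_int u + of_nat n * of_int v \<in> P"
        by (intro P'(5) P'(6) P'(1) n integers_closed)
      moreover have "of_nat p * of_int u + of_nat n * of_int v = (of_int (u * int p + v * int n) :: complex)"
        by (simp add: mult.commute)
      ultimately show False using uv P'(2) by simp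
    qed
    thus ?thesis
      unfolding integral_at_def by (intro bexI[of _ 1] bexI[of _ "of_nat n"]) (auto simp: divide_inverse)
  qed
  thus ?thesis by (simp add: p_integers_def)
qed

text \<open>Ensures that both orders are finite. Since x need not be integral, it is treated as the
  quotient of the integers \<open>n * x\<close> and n, each having a power congruent to 1.\<close>

lemma exists_power_cong_1:
  assumes p: "Factorial_Ring.prime p" and x: "prime_to K p x"
    and n: "coprime p n" "of_nat n * x \<in> ring_of_integers K"
  shows "\<exists>k\<ge>1. cong_mod K p (x ^ k) 1"
proof -
  have p1: "p > 1" using p prime_gt_1_nat by blast
  have "n \<noteq> 0" using n(1) p1 by (cases "n = 0") auto
  \<comment> \<open>Two powers of y agree modulo p; dividing by the smaller one is allowed because y
    is a unit at p.\<close>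
  have cong1: "\<exists>k\<ge>1. \<exists>w\<in>p_integers K p. y ^ k = 1 + of_nat p * w"
    if y: "y \<in> ring_of_integers K" "y \<noteq> 0" "inverse y \<in> p_integers K p" for y
  proof -
    have "algebraic_int y" using y by (simp add: ring_of_integers_def)
    then obtain i j where ij: "i < j" "algebraic_int ((y ^ j - y ^ i) / of_nat p)"
      by (rule algebraic_int_powers_congruent[of y p]) (use p1 in auto)
    define w where "w = (y ^ j - y ^ i) / of_nat p"
    have "w \<in> ring_of_integers K"
      using ij integers_subset[OF y(1)] by (simp add: w_def ring_of_integers_def)
    hence "inverse y ^ i * w \<in> p_integers K p"
      using integers_subset_p_integers[of w p] y(3) by simp
    moreover have "y ^ (j - i) = 1 + of_nat p * (inverse y ^ i * w)"
      using ij y p1 by (simp add: w_def field_simps power_diff)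
    moreover have "j - i \<ge> 1" using ij by simp
    ultimately show ?thesis by blast
  qed
  have nx: "of_nat n * x \<noteq> 0" "inverse (of_nat n * x) \<in> p_integers K p"
    using x n of_nat_coprime_unit[OF n(1)] \<open>n \<noteq> 0\<close> by (auto simp: prime_to_iff)
  obtain k w where k: "k \<ge> 1" "w \<in> p_integers K p" "(of_nat n * x) ^ k = 1 + of_nat p * w"
    using cong1[OF n(2) nx] by blast
  obtain l v where l: "l \<ge> 1" "v \<in> p_integers K p" "(of_nat n :: complex) ^ l = 1 + of_nat p * v"
    using cong1[of "of_nat n"] of_nat_coprime_unit[OF n(1)] \<open>n \<noteq> 0\<close> by auto
  \<comment> \<open>Needed to raise both congruences to the common exponent
    \<open>k * l\<close>.\<close>
  have pow: "\<exists>u\<in>p_integers K p. (1 + of_nat p * t) ^ m = 1 + of_nat p * u"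
    if "t \<in> p_integers K p" for t m
  proof (induction m)
    case (Suc m)
    then obtain u where u: "u \<in> p_integers K p" "(1 + of_nat p * t) ^ m = 1 + of_nat p * u" by blast
    have "(1 + of_nat p * t) ^ Suc m = 1 + of_nat p * (u + t + of_nat p * t * u)"
      unfolding power_Suc u(2) by (simp add: algebra_simps)
    moreover have "u + t + of_nat p * t * u \<in> p_integers K p" using u(1) that by simp
    ultimately show ?case by blast
  qed (auto intro: bexI[of _ 0])
  obtain w' where w': "w' \<in> p_integers K p" "(of_nat n * x) ^ (k * l) = 1 + of_nat p * w'"
    using pow[OF k(2), of l] k by (auto simp: power_mult)
  obtain v' where v': "v' \<in> p_integers K p" "(of_nat n :: complex) ^ (k * l) = 1 + of_nat p * v'"
    using pow[OF l(2), of k] l by (auto simp: power_mult mult.commute[of k])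
  define i where "i = inverse (1 + of_nat p * v')"
  have i: "i \<in> p_integers K p" "1 + of_nat p * v' \<noteq> 0"
    using one_plus_p_unit[OF p1 v'(1)] by (auto simp: i_def)
  have "(1 + of_nat p * v') * x ^ (k * l) = 1 + of_nat p * w'"
    using w' v' by (simp add: power_mult_distrib)
  hence "x ^ (k * l) = (1 + of_nat p * w') * i"
    using i(2) by (simp add: i_def field_simps)
  \<comment> \<open>Uses \<open>1 = (1 + p * v') * i\<close>, so the two leading terms
    cancel.\<close>
  also have "\<dots> - 1 = of_nat p * ((w' - v') * i)"
    using i(2) by (simp add: i_def field_simps)
  finally have "x ^ (k * l) - 1 = of_nat p * ((w' - v') * i)" .
  hence "cong_mod K p (x ^ (k * l)) 1"
    unfolding cong_mod_def using x w' v' i by (auto simp: prime_to_iff)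
  moreover have "k * l \<ge> 1" using k l by simp
  ultimately show ?thesis by blast
qed

section \<open>The unit group and its quotient by roots of unity and principal units\<close>

lemma p_unit_group_simps [simp]:
  "mult (p_unit_group K p) = (*)" "one (p_unit_group K p) = 1"
  "carrier (p_unit_group K p) = {x. prime_to K p x}"
proof -
  show "mult (p_unit_group K p) = (*)" "one (p_unit_group K p) = 1"
    by (simp_all add: p_unit_group_def units_of_def)
  have "(\<exists>y\<in>p_integers K p. y * x = 1 \<and> x * y = 1) \<longleftrightarrow> x \<noteq> 0 \<and> inverse x \<in> p_integers K p" for x
    by (metis inverse_unique left_inverse mult_zero_right right_inverse zero_neq_one)
  thus "carrier (p_unit_group K p) = {x. prime_to K p x}"
    by (auto simp: p_unit_group_def units_of_def Units_def prime_to_iff)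
qed

lemma comm_group_p_units: "comm_group (p_unit_group K p)"
proof -
  interpret R: cring "complex_ring\<lparr>carrier := p_integers K p\<rparr>"
    by (rule cring_of_subring[OF subring_p_integers])
  show ?thesis unfolding p_unit_group_def by (rule R.units_comm_group)
qed

lemma p_unit_group_pow: "x [^]\<^bsub>p_unit_group K p\<^esub> (n::nat) = x ^ n"
  by (induction n) (simp_all add: nat_pow_def mult.commute)

lemma root_of_unity_prime_to: "\<zeta> \<in> roots_of_unity K \<Longrightarrow> prime_to K p \<zeta>"
  using roots_of_unity_closed[of \<zeta>] roots_of_unity_integer
  by (auto simp: prime_to_iff integers_subset_p_integers)

lemma subgroup_mu_principal_units:
  assumes p: "p > 1"
  shows "subgroup (mu_principal_units K p) (p_unit_group K p)"
proof -
  interpret G: comm_group "p_unit_group K p" by (rule comm_group_p_units)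
  have unit: "prime_to K p (1 + of_nat p * z)" if "z \<in> p_integers K p" for z
    using one_plus_p_unit[OF p that] that by (auto simp: prime_to_iff)
  show ?thesis
  proof (rule G.subgroupI)
    show "mu_principal_units K p \<subseteq> carrier (p_unit_group K p)"
    proof
      fix x assume "x \<in> mu_principal_units K p"
      then obtain \<zeta> z where "\<zeta> \<in> roots_of_unity K" "z \<in> p_integers K p" "x = \<zeta> * (1 + of_nat p * z)"
        by (auto simp: mu_principal_units_def)
      thus "x \<in> carrier (p_unit_group K p)"
        using G.m_closed[of \<zeta> "1 + of_nat p * z"] unit root_of_unity_prime_to by simp
    qed
    show "mu_principal_units K p \<noteq> {}"
      using one_root_of_unity p_integers_closed(1) by (fastforce simp: mu_principal_units_def)
  next
    fix x assume "x \<in> mu_principal_units K p"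
    then obtain \<zeta> z where x: "\<zeta> \<in> roots_of_unity K" "z \<in> p_integers K p" "x = \<zeta> * (1 + of_nat p * z)"
      by (auto simp: mu_principal_units_def)
    note u = one_plus_p_unit[OF p x(2)]
    note \<zeta> = roots_of_unity_closed[OF x(1)]
    \<comment> \<open>The inverse of x, written with
      \<open>1 / (1 + p * z) = 1 - p * z / (1 + p * z)\<close> so that membership in the subgroup is
      visible.\<close>
    define y where "y = inverse \<zeta> * (1 + of_nat p * (- z * inverse (1 + of_nat p * z)))"
    have "1 + of_nat p * (- z * inverse (1 + of_nat p * z)) = inverse (1 + of_nat p * z)"
      using u(1) by (simp add: field_simps)
    hence "y = inverse x"
      using x(3) by (simp add: y_def)
    moreover have "prime_to K p x"
      using x G.m_closed[of \<zeta> "1 + of_nat p * z"] unit root_of_unity_prime_to by simp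
    ultimately have "inv\<^bsub>p_unit_group K p\<^esub> x = y"
      by (intro G.inv_equality) (auto simp: prime_to_iff)
    moreover have "y \<in> mu_principal_units K p"
      unfolding y_def mu_principal_units_def using u x \<zeta> by blast
    ultimately show "inv\<^bsub>p_unit_group K p\<^esub> x \<in> mu_principal_units K p" by simp
  next
    fix x y assume "x \<in> mu_principal_units K p" "y \<in> mu_principal_units K p"
    then obtain \<zeta> z \<xi> w where
      x: "\<zeta> \<in> roots_of_unity K" "z \<in> p_integers K p" "x = \<zeta> * (1 + of_nat p * z)" and
      y: "\<xi> \<in> roots_of_unity K" "w \<in> p_integers K p" "y = \<xi> * (1 + of_nat p * w)"
      by (auto simp: mu_principal_units_def)
    have "x * y = (\<zeta> * \<xi>) * (1 + of_nat p * (z + w + of_nat p * z * w))"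
      using x y by (simp add: algebra_simps)
    moreover have "\<zeta> * \<xi> \<in> roots_of_unity K" "z + w + of_nat p * z * w \<in> p_integers K p"
      using x y roots_of_unity_closed(3) by auto
    ultimately show "x \<otimes>\<^bsub>p_unit_group K p\<^esub> y \<in> mu_principal_units K p"
      unfolding mu_principal_units_def by auto
  qed
qed

text \<open>The exponent k witnesses that the class of x has finite order, which excludes the
  default value 0 of \<open>ord\<close>; the order is then itself an exponent to which the bounds
  apply.\<close>

lemma order_mod_mu_cong:
  assumes p: "p > 1" and x: "prime_to K p x" and k: "k \<ge> 1" "cong_mod K p (x ^ k) 1"
  shows "order_mod_mu K p x \<ge> 1"
    and "\<exists>\<zeta>\<in>roots_of_unity K. cong_mod K p (x ^ order_mod_mu K p x) \<zeta>"
proof -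
  let ?G = "p_unit_group K p" and ?H = "mu_principal_units K p"
  interpret G: comm_group ?G by (rule comm_group_p_units)
  have H: "subgroup ?H ?G" by (rule subgroup_mu_principal_units[OF p])
  hence N: "?H \<lhd> ?G" by (rule G.subgroup_imp_normal)
  interpret N: normal ?H ?G by (fact N)
  interpret Q: group "?G Mod ?H" by (rule N.factorgroup_is_group)
  let ?c = "?H #>\<^bsub>?G\<^esub> x"
  have c: "?c \<in> carrier (?G Mod ?H)"
    using x by (auto simp: FactGroup_def RCOSETS_def)
  have xn: "x ^ n \<in> carrier ?G" for n
    using G.nat_pow_closed[of x n] x by (simp add: p_unit_group_pow)
  have cpow: "?c [^]\<^bsub>?G Mod ?H\<^esub> n = ?H #>\<^bsub>?G\<^esub> (x ^ n)" for n :: nat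
  proof (induction n)
    case 0
    show ?case using G.coset_mult_one[of ?H] N.subset by (simp add: FactGroup_def)
  next
    case (Suc n)
    thus ?case using N.rcos_sum[of "x ^ n" x] xn x by (simp add: FactGroup_def mult.commute)
  qed
  \<comment> \<open>A coset is the identity of the quotient exactly when its representative lies in
    the subgroup.\<close>
  have trivial: "?c [^]\<^bsub>?G Mod ?H\<^esub> n = \<one>\<^bsub>?G Mod ?H\<^esub> \<longleftrightarrow> x ^ n \<in> ?H" for n :: nat
    unfolding cpow using G.coset_join1[of ?H "x ^ n"] G.coset_join2[of "x ^ n" ?H] xn H
    by (auto simp: FactGroup_def)
  have ord: "order_mod_mu K p x = Q.ord ?c" by (simp add: order_mod_mu_def)
  from k obtain z where "z \<in> p_integers K p" "x ^ k = 1 * (1 + of_nat p * z)"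
    by (auto simp: cong_mod_def algebra_simps)
  hence "x ^ k \<in> ?H"
    unfolding mu_principal_units_def using one_root_of_unity by blast
  hence "Q.ord ?c \<noteq> 0"
    using Q.ord_eq_0[OF c] trivial k by auto
  thus "order_mod_mu K p x \<ge> 1" by (simp add: ord)
  have "x ^ Q.ord ?c \<in> ?H"
    using Q.pow_ord_eq_1[OF c] trivial by blast
  then obtain \<zeta> w where w: "\<zeta> \<in> roots_of_unity K" "w \<in> p_integers K p"
    "x ^ Q.ord ?c = \<zeta> * (1 + of_nat p * w)"
    by (auto simp: mu_principal_units_def)
  \<comment> \<open>Expanding \<open>\<zeta> * (1 + p * w)\<close> turns subgroup membership into a
    congruence with a root of unity.\<close>
  have "x ^ Q.ord ?c - \<zeta> = of_nat p * (\<zeta> * w)"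
    using w by (simp add: algebra_simps)
  hence "cong_mod K p (x ^ order_mod_mu K p x) \<zeta>"
    unfolding cong_mod_def ord
    using w x roots_of_unity_integer[OF w(1)] integers_subset_p_integers
    by (auto simp: prime_to_iff)
  thus "\<exists>\<zeta>\<in>roots_of_unity K. cong_mod K p (x ^ order_mod_mu K p x) \<zeta>"
    using w by blast
qed

end

section \<open>Bounds on the exponent\<close>

context galois_number_field
begin

lemma cong_root_of_unity_bound:
  assumes x: "x \<in> K" "x \<notin> roots_of_unity K"
    and n: "n > 0" "of_nat n * x \<in> ring_of_integers K"
    and k: "k \<ge> 1" and \<zeta>: "\<zeta> \<in> roots_of_unity K" "cong_mod K p (x ^ k) \<zeta>" and p: "p > 0"
  shows "real p \<le> real n ^ k * (max_conjugate K x ^ k + 1)"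
proof -
  obtain z where z: "z \<in> p_integers K p" "x ^ k - \<zeta> = of_nat p * z"
    using \<zeta> by (auto simp: cong_mod_def)
  obtain m :: nat where m: "m > 0" "\<zeta> ^ m = 1"
    using \<zeta> by (auto simp: roots_of_unity_def)
  \<comment> \<open>The power of n clears the denominator of \<open>x ^ k\<close>, so
    \<open>p * w\<close> is integral. As w is also a p-integer, it is integral itself.\<close>
  define w where "w = of_nat n ^ k * z"
  have pw: "of_nat p * w = (of_nat n * x) ^ k + - (of_nat n ^ k * \<zeta>)"
    using z by (simp add: w_def algebra_simps power_mult_distrib)
  have "of_nat p * w \<in> ring_of_integers K"
    unfolding pw using integers_power[OF n(2), of k] roots_of_unity_integer[OF \<zeta>(1)]
    by (intro integers_closed(3)) simp_all
  moreover have "w \<in> p_integers K p" using z by (auto simp: w_def)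
  ultimately have w: "w \<in> ring_of_integers K" by (rule integer_if_p_integer[rotated])
  \<comment> \<open>Equality would make x a root of unity of order dividing
    \<open>k * m\<close>.\<close>
  have "x ^ k \<noteq> \<zeta>"
  proof
    assume "x ^ k = \<zeta>"
    hence "x ^ (k * m) = 1" using m by (simp add: power_mult)
    moreover have "k * m > 0" using k m by simp
    ultimately show False using x unfolding roots_of_unity_def by blast
  qed
  hence "w \<noteq> 0" using z n by (auto simp: w_def)
  then obtain \<sigma> where \<sigma>: "\<sigma> \<in> galois_group K" "cmod (\<sigma> w) \<ge> 1"
    using exists_large_conjugate w by blast
  have \<zeta>K: "\<zeta> \<in> K" using \<zeta> by (simp add: roots_of_unity_def)
  have "\<sigma> (of_nat p * w) = \<sigma> (of_nat n ^ k * (x ^ k - \<zeta>))"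
    unfolding pw by (simp add: algebra_simps power_mult_distrib)
  hence "of_nat p * \<sigma> w = of_nat n ^ k * (\<sigma> x ^ k - \<sigma> \<zeta>)"
    using x \<zeta>K integers_subset[OF w] \<sigma>
    by (simp add: galois_hom galois_power galois_diff galois_rat)
  hence eq: "real p * cmod (\<sigma> w) = real n ^ k * cmod (\<sigma> x ^ k - \<sigma> \<zeta>)"
    by (metis norm_mult norm_power norm_of_nat)
  \<comment> \<open>Conjugates of roots of unity are roots of unity, so \<zeta> contributes exactly
    1 to the triangle inequality.\<close>
  have "\<sigma> \<zeta> ^ m = 1"
    using galois_power[OF \<sigma>(1) \<zeta>K, of m] m galois_hom(3)[OF \<sigma>(1)] by simp
  hence "cmod (\<sigma> \<zeta>) ^ m = 1" by (metis norm_one norm_power)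
  hence "cmod (\<sigma> \<zeta>) = 1"
    using m power_eq_imp_eq_base[of "cmod (\<sigma> \<zeta>)" m 1] by simp
  hence "cmod (\<sigma> x ^ k - \<sigma> \<zeta>) \<le> cmod (\<sigma> x) ^ k + 1"
    using norm_triangle_ineq4[of "\<sigma> x ^ k" "\<sigma> \<zeta>"] by (simp add: norm_power)
  also have "\<dots> \<le> max_conjugate K x ^ k + 1"
    using max_conjugate_ge[OF \<sigma>(1), of x] by (intro add_mono power_mono) auto
  finally have "real n ^ k * cmod (\<sigma> x ^ k - \<sigma> \<zeta>) \<le> real n ^ k * (max_conjugate K x ^ k + 1)"
    by (intro mult_left_mono) auto
  moreover have "real p \<le> real p * cmod (\<sigma> w)"
    using \<sigma> p by simp
  ultimately show ?thesis using eq by simp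
qed

lemma max_conjugate_pos:
  assumes "x \<in> K" "x \<noteq> 0"
  shows "max_conjugate K x > 0"
  using max_conjugate_ge[OF galois_id, of x] assms by (simp add: less_le_trans[of 0 "cmod x"])

lemma exponent_bounds:
  assumes x: "x \<in> K - {0}" "x \<notin> roots_of_unity K"
    and n: "n > 0" "of_nat n * x \<in> ring_of_integers K"
    and k: "k \<ge> 1" and \<zeta>: "\<exists>\<zeta>\<in>roots_of_unity K. cong_mod K p (x ^ k) \<zeta>" and p: "p > 1"
  shows "(ln (real p) - ln 2) / max (ln (real n * max_conjugate K x)) (ln (real n)) \<le> real k"
    and "x \<in> ring_of_integers K \<Longrightarrow> ln (real p - 1) / ln (max_conjugate K x) \<le> real k"
proof -
  define c where "c = max_conjugate K x"
  have c: "c > 0" using max_conjugate_pos x by (simp add: c_def)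
  show "(ln (real p) - ln 2) / max (ln (real n * c)) (ln (real n)) \<le> real k"
  proof (cases "max (ln (real n * c)) (ln (real n)) = 0")
    case False
    \<comment> \<open>M dominates both bases, so the sum of the two k-th powers is at most
      \<open>2 * M ^ k\<close>; this is the source of \<open>ln 2\<close>.\<close>
    define M where "M = max (real n * c) (real n)"
    have M: "M > 0" using n by (simp add: M_def less_max_iff_disj)
    have lnM: "max (ln (real n * c)) (ln (real n)) = ln M"
      using n c by (auto simp: M_def max_def)
    \<comment> \<open>As n is at least 1, a nonzero denominator is positive, and the final division
      keeps the direction of the inequality.\<close>
    have "ln M \<ge> ln (real n)" unfolding lnM[symmetric] by simp
    moreover have "ln (real n) \<ge> 0" using n by simp
    ultimately have pos: "ln M > 0" using False lnM by linarith
    have "real p \<le> real n ^ k * (c ^ k + 1)"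
      unfolding c_def using cong_root_of_unity_bound x n k \<zeta> p by auto
    also have "\<dots> = (real n * c) ^ k + real n ^ k"
      by (simp add: algebra_simps power_mult_distrib)
    also have "\<dots> \<le> M ^ k + M ^ k"
      using n c by (intro add_mono power_mono) (auto simp: M_def)
    finally have "real p / 2 \<le> M ^ k" by simp
    hence "ln (real p / 2) \<le> ln (M ^ k)"
      using p M by (subst ln_le_cancel_iff) auto
    hence "ln (real p) - ln 2 \<le> real k * ln M"
      using p M by (simp add: ln_div ln_realpow)
    thus ?thesis unfolding lnM using pos by (simp add: divide_le_eq)
  qed simp
  assume int: "x \<in> ring_of_integers K"
  \<comment> \<open>For integral x this yields \<open>c \<ge> 1\<close>, which fixes the sign of
    \<open>ln c\<close>.\<close>
  obtain \<sigma> where "\<sigma> \<in> galois_group K" "cmod (\<sigma> x) \<ge> 1"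
    using exists_large_conjugate[OF int] x by auto
  hence "c \<ge> 1" using max_conjugate_ge[of \<sigma> x] by (simp add: c_def)
  show "ln (real p - 1) / ln c \<le> real k"
  proof (cases "c = 1")
    case False
    hence pos: "ln c > 0" using \<open>c \<ge> 1\<close> by simp
    \<comment> \<open>With denominator 1 the summand 1 moves to the left, giving
      \<open>p - 1 \<le> c ^ k\<close> without the factor 2.\<close>
    have "real p \<le> real 1 ^ k * (c ^ k + 1)"
      unfolding c_def using cong_root_of_unity_bound[of x 1 k] x int k \<zeta> p by auto
    hence "ln (real p - 1) \<le> ln (c ^ k)"
      using p c by (subst ln_le_cancel_iff) auto
    thus ?thesis using pos c by (simp add: divide_le_eq ln_realpow)
  qed simp
qed

end

theorem theorem4p1:
  fixes K :: "complex set" and \<eta> :: complex and \<nu> p :: nat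
  assumes "finite_galois K"
    and "\<eta> \<in> K - {0}" and "\<eta> \<notin> roots_of_unity K"
    and "\<nu> > 0" and "of_nat \<nu> * \<eta> \<in> ring_of_integers K"
    and "Factorial_Ring.prime p" and "prime_to K p \<eta>" and "coprime p \<nu>"
  shows
    "(\<forall>k::nat. k \<ge> 1 \<and> (\<exists>\<zeta>\<in>roots_of_unity K. cong_mod K p (\<eta> ^ k) \<zeta>) \<longrightarrow>
        real k \<ge> (ln (real p) - ln 2) /
                   max (ln (real \<nu> * max_conjugate K \<eta>)) (ln (real \<nu>)) \<and>
        (\<eta> \<in> ring_of_integers K \<longrightarrow>
           real k \<ge> ln (real p - 1) / ln (max_conjugate K \<eta>)))
     \<and> (real (order_mod_mu K p \<eta>) \<ge> (ln (real p) - ln 2) /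
          max (ln (real \<nu> * max_conjugate K \<eta>)) (ln (real \<nu>)) \<and>
        (\<eta> \<in> ring_of_integers K \<longrightarrow>
           real (order_mod_mu K p \<eta>) \<ge> ln (real p - 1) / ln (max_conjugate K \<eta>)))
     \<and> (real (order_mod K p \<eta>) \<ge> (ln (real p) - ln 2) /
          max (ln (real \<nu> * max_conjugate K \<eta>)) (ln (real \<nu>)) \<and>
        (\<eta> \<in> ring_of_integers K \<longrightarrow>
           real (order_mod K p \<eta>) \<ge> ln (real p - 1) / ln (max_conjugate K \<eta>)))"
proof -
  interpret galois_number_field K by unfold_locales (fact assms(1))
  have p: "p > 1" using assms(6) prime_gt_1_nat by blast
  have bounds: "real k \<ge> (ln (real p) - ln 2) /
                   max (ln (real \<nu> * max_conjugate K \<eta>)) (ln (real \<nu>)) \<and>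
        (\<eta> \<in> ring_of_integers K \<longrightarrow> real k \<ge> ln (real p - 1) / ln (max_conjugate K \<eta>))"
    if "k \<ge> 1" "\<exists>\<zeta>\<in>roots_of_unity K. cong_mod K p (\<eta> ^ k) \<zeta>" for k :: nat
    using exponent_bounds[OF assms(2-5) that p] by blast
  obtain k where k: "k \<ge> 1" "cong_mod K p (\<eta> ^ k) 1"
    using exists_power_cong_1[OF assms(6,7,8,5)] by blast
  \<comment> \<open>The exponent k shows that \<open>LEAST\<close> ranges over a nonempty set. Since
    1 is a root of unity, the general bounds then cover this order too.\<close>
  have "order_mod K p \<eta> \<ge> 1 \<and> cong_mod K p (\<eta> ^ order_mod K p \<eta>) 1"
    unfolding order_mod_def by (rule LeastI[of _ k]) (use k in auto)
  thus ?thesis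
    using bounds order_mod_mu_cong[OF p assms(7) k] one_root_of_unity by blast
qed

end
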